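(* Let $A,B$ be commuting positive definite complex $n\times n$ matrices and let $0\leq t\leq 1$. Then $$\left(\frac{AB^{-1}+BA^{-1}+2I}{4}\right)^{4t(1-t)}\,!_t(A,B)\leq A\nabla B,$$ where $I$ is the $n\times n$ identity matrix.
   Context: For Hermitian matrices, $A\leq B$ means $B-A$ is positive semidefinite (Loewner order). For positive definite $A,B$ and $0\le t\le1$: $A!_tB=((1-t)A^{-1}+tB^{-1})^{-1}$, $A\nabla B=\frac{A+B}{2}$, and the harmonic Heinz mean is $!_t(A,B)=\frac{A!_tB+A!_{1-t}B}{2}$. Real powers of positive definite matrices are defined by functional calculus. *)

theory Defs
  imports
    "Jordan_Normal_Form.Gauss_Jordan_Elimination"
    "Jordan_Normal_Form.Schur_Decomposition"
begin

definition hermitian_mat :: "complex mat \<Rightarrow> bool" where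
  "hermitian_mat A \<longleftrightarrow> mat_adjoint A = A"

text \<open>The order on complex numbers is \<open>z \<le> w \<longleftrightarrow> Re z \<le> Re w \<and> Im z = Im w\<close>,
  so the inequalities below also say that the quadratic form is real.\<close>

definition psd_mat :: "complex mat \<Rightarrow> bool" where
  "psd_mat A \<longleftrightarrow> hermitian_mat A \<and>
     (\<forall>v \<in> carrier_vec (dim_row A). 0 \<le> (A *\<^sub>v v) \<bullet>c v)"

definition pd_mat :: "complex mat \<Rightarrow> bool" where
  "pd_mat A \<longleftrightarrow> hermitian_mat A \<and>
     (\<forall>v \<in> carrier_vec (dim_row A). v \<noteq> 0\<^sub>v (dim_row A) \<longrightarrow> 0 < (A *\<^sub>v v) \<bullet>c v)"

definition loewner_le :: "complex mat \<Rightarrow> complex mat \<Rightarrow> bool" (infix \<open>\<le>\<^sub>L\<close> 50) where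
  "A \<le>\<^sub>L B \<longleftrightarrow> hermitian_mat A \<and> hermitian_mat B \<and> dim_row A = dim_row B \<and> psd_mat (B - A)"

text \<open>Meaningful only for invertible \<open>A\<close>.\<close>

definition inv_mat :: "complex mat \<Rightarrow> complex mat" where
  "inv_mat A = the (mat_inverse A)"

definition unitary_mat :: "nat \<Rightarrow> complex mat \<Rightarrow> bool" where
  "unitary_mat n U \<longleftrightarrow> U \<in> carrier_mat n n \<and>
     mat_adjoint U * U = 1\<^sub>m n \<and> U * mat_adjoint U = 1\<^sub>m n"

text \<open>Functional calculus of a Hermitian matrix: \<open>f(U diag(d) U\<^sup>*) = U diag(f(d)) U\<^sup>*\<close> for
  any unitary diagonalization with real eigenvalues \<open>d\<close>; the result does not depend on the
  diagonalization chosen.\<close>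

definition fun_calc :: "(real \<Rightarrow> real) \<Rightarrow> complex mat \<Rightarrow> complex mat" where
  "fun_calc f A = (THE X. \<exists>U (d :: nat \<Rightarrow> real). unitary_mat (dim_row A) U \<and>
     A = U * mat_diag (dim_row A) (\<lambda>i. complex_of_real (d i)) * mat_adjoint U \<and>
     X = U * mat_diag (dim_row A) (\<lambda>i. complex_of_real (f (d i))) * mat_adjoint U)"

definition mat_powr :: "complex mat \<Rightarrow> real \<Rightarrow> complex mat" where
  "mat_powr A r = fun_calc (\<lambda>x. x powr r) A"

definition arith_mean :: "complex mat \<Rightarrow> complex mat \<Rightarrow> complex mat" where
  "arith_mean A B = (1 / 2) \<cdot>\<^sub>m (A + B)"

definition harm_mean :: "real \<Rightarrow> complex mat \<Rightarrow> complex mat \<Rightarrow> complex mat" where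
  "harm_mean t A B = inv_mat
     (complex_of_real (1 - t) \<cdot>\<^sub>m inv_mat A + complex_of_real t \<cdot>\<^sub>m inv_mat B)"

definition harm_heinz_mean :: "real \<Rightarrow> complex mat \<Rightarrow> complex mat \<Rightarrow> complex mat" where
  "harm_heinz_mean t A B = (1 / 2) \<cdot>\<^sub>m (harm_mean t A B + harm_mean (1 - t) A B)"

end

theory Submission
  imports Defs "Jordan_Normal_Form.Spectral_Radius"
begin

text \<open>
  Commuting Hermitian matrices have a common orthonormal eigenbasis, so \<open>A\<close>, \<open>B\<close> and the
  inverses, powers and means formed from them become diagonal after conjugation with
  one unitary \<open>U\<close>, and the Loewner inequality splits into one scalar inequality for each pair \<open>a, b > 0\<close> of joint
  eigenvalues.

  For the scalars put \<open>k = (a/b + b/a + 2)/4 = (a+b)\<^sup>2/(4ab)\<close> and \<open>r = 4t(1-t)\<close>, which lies in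
  \<open>[0, 1]\<close>. The product of the denominators of the two harmonic means satisfies
  \<open>((1-t)b + ta)(tb + (1-t)a) = ab(rk + 1 - r)\<close>, and therefore the harmonic Heinz mean of
  \<open>a\<close> and \<open>b\<close> equals \<open>(a+b)/2\<close> divided by \<open>rk + 1 - r\<close>. The claim thus becomes Bernoulli's
  inequality \<open>k\<^sup>r \<le> rk + 1 - r\<close> (lemmas \<open>powr_le_affine\<close> and
  \<open>powr_mult_harmonic_heinz_le_arith\<close>).

  The common eigenbasis comes from the spectral theorem for the normal matrix \<open>C = A + \<i>B\<close>
  (\<open>normal_mat_unitarily_diagonalizable\<close>): \<open>A\<close> and \<open>\<i>B\<close> are the Hermitian and
  skew-Hermitian parts of \<open>C\<close>, so a unitary that diagonalizes \<open>C\<close>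
  diagonalizes \<open>A\<close> and \<open>B\<close>, with eigenvalues the real and imaginary parts of those of \<open>C\<close>. The functional calculus is given by a definite description,
  so it can be evaluated on a diagonalization only once its result is known to be independent
  of the diagonalization (\<open>udiag_fun_unique\<close>).
\<close>

section \<open>Adjoints and unitary matrices\<close>

lemma mat_adjoint_carrier [simp]:
  "A \<in> carrier_mat nr nc \<Longrightarrow> mat_adjoint A \<in> carrier_mat nc nr"
  unfolding mat_adjoint_def carrier_mat_def by simp

lemma mat_adjoint_dims [simp]:
  "dim_row (mat_adjoint A) = dim_col A" "dim_col (mat_adjoint A) = dim_row A"
  unfolding mat_adjoint_def by simp_all

lemma mat_adjoint_index [simp]:
  fixes A :: "complex mat"
  assumes "i < dim_col A" and "j < dim_row A"
  shows "mat_adjoint A $$ (i, j) = cnj (A $$ (j, i))"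
  using assms unfolding mat_adjoint_def by (simp add: mat_of_rows_index)

lemma mat_adjoint_adjoint [simp]: "mat_adjoint (mat_adjoint A) = (A :: complex mat)"
  by (rule eq_matI) auto

lemma mat_adjoint_mult:
  fixes A B :: "complex mat"
  assumes "A \<in> carrier_mat nr n" and "B \<in> carrier_mat n nc"
  shows "mat_adjoint (A * B) = mat_adjoint B * mat_adjoint A"
  using assms by (intro eq_matI) (auto simp: scalar_prod_def mult.commute intro!: sum.cong)

lemma mat_adjoint_add:
  fixes A B :: "complex mat"
  assumes "A \<in> carrier_mat nr nc" and "B \<in> carrier_mat nr nc"
  shows "mat_adjoint (A + B) = mat_adjoint A + mat_adjoint B"
  using assms by (intro eq_matI) auto

lemma mat_adjoint_smult:
  "mat_adjoint (c \<cdot>\<^sub>m A) = cnj c \<cdot>\<^sub>m mat_adjoint (A :: complex mat)"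
  by (intro eq_matI) auto

lemma mat_adjoint_mat_diag:
  "mat_adjoint (mat_diag n d) = mat_diag n (\<lambda>i. cnj (d i))"
  by (intro eq_matI) (auto simp: mat_diag_def)

lemma adjoint_cscalar_prod:
  fixes A :: "complex mat"
  assumes A: "A \<in> carrier_mat n m" and v: "v \<in> carrier_vec m" and w: "w \<in> carrier_vec n"
  shows "(A *\<^sub>v v) \<bullet>c w = v \<bullet>c (mat_adjoint A *\<^sub>v w)"
proof -
  have "(A *\<^sub>v v) \<bullet>c w = (\<Sum>i<n. (\<Sum>j<m. A $$ (i, j) * v $ j) * cnj (w $ i))"
    using assms by (auto simp: scalar_prod_def lessThan_atLeast0 intro!: sum.cong)
  also have "\<dots> = (\<Sum>i<n. \<Sum>j<m. A $$ (i, j) * v $ j * cnj (w $ i))"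
    by (simp add: sum_distrib_right)
  also have "\<dots> = (\<Sum>j<m. \<Sum>i<n. A $$ (i, j) * v $ j * cnj (w $ i))"
    by (rule sum.swap)
  also have "\<dots> = (\<Sum>j<m. v $ j * cnj (\<Sum>i<n. cnj (A $$ (i, j)) * w $ i))"
    by (simp add: sum_distrib_left ac_simps)
  also have "\<dots> = v \<bullet>c (mat_adjoint A *\<^sub>v w)"
    using assms by (auto simp: scalar_prod_def lessThan_atLeast0 simp del: cnj_sum intro!: sum.cong)
  finally show ?thesis .
qed

lemma unitary_matI:
  assumes "U \<in> carrier_mat n n" and "mat_adjoint U * U = 1\<^sub>m n"
  shows "unitary_mat n U"
  using assms mat_mult_left_right_inverse[of "mat_adjoint U" n U]
  unfolding unitary_mat_def by simp

lemma unitary_mat_mult: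
  assumes "unitary_mat n U" and "unitary_mat n V"
  shows "unitary_mat n (U * V)"
proof (rule unitary_matI)
  note [simp] = assoc_mult_mat[of _ n n _ n _ n] mult_carrier_mat[of _ n n _ n]
    left_mult_one_mat[of _ n n] right_mult_one_mat[of _ n n]
  have U: "U \<in> carrier_mat n n" "mat_adjoint U * U = 1\<^sub>m n"
    and V: "V \<in> carrier_mat n n" "mat_adjoint V * V = 1\<^sub>m n"
    using assms by (auto simp: unitary_mat_def)
  show "U * V \<in> carrier_mat n n" using U V by simp
  have "mat_adjoint (U * V) * (U * V) = mat_adjoint V * (mat_adjoint U * U) * V"
    using U(1) V(1) by (simp add: mat_adjoint_mult[of _ n n _ n])
  then show "mat_adjoint (U * V) * (U * V) = 1\<^sub>m n" using U V by simp
qed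

text \<open>Complete \<open>v\<close> to a basis, orthogonalize it and normalize. The Gram-Schmidt process leaves the
  first vector unchanged, and normalization only rescales it.\<close>

lemma unitary_extending_vector:
  fixes v :: "complex vec"
  assumes v: "v \<in> carrier_vec n" and v0: "v \<noteq> 0\<^sub>v n"
  obtains W c where "unitary_mat n W" and "col W 0 = c \<cdot>\<^sub>v v"
proof -
  interpret cof_vec_space n "TYPE(complex)" .
  define b where "b = basis_completion v"
  define ws where "ws = gram_schmidt n b"
  have n: "0 < n" using v v0 by (cases n) auto
  note bc = basis_completion[OF v v0, folded b_def]
  obtain vs where bv: "b = v # vs" using bc(6,7) n by (cases b) auto
  have ws: "set ws \<subseteq> carrier_vec n" "corthogonal ws" "length ws = n"
    using gram_schmidt_result[OF bc(2,4,5) ws_def] bc(6) by auto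
  have hd_ws: "ws ! 0 = v"
    using gram_schmidt_hd[OF v, of vs] ws(3) n
    unfolding ws_def bv by (metis hd_conv_nth length_greater_0_conv)
  have wc: "ws ! i \<in> carrier_vec n" if "i < n" for i using ws(1,3) that by auto
  (* The norms of the orthogonalized vectors, typed as complex numbers to serve as divisors. *)
  define s where "s i = complex_of_real (sqrt (Re (ws ! i \<bullet>c ws ! i)))" for i
  have s: "s i * s i = ws ! i \<bullet>c ws ! i" "s i \<noteq> 0" "cnj (s i) = s i" if "i < n" for i
  proof -
    have nz: "ws ! i \<bullet>c ws ! i \<noteq> 0" using corthogonalD[OF ws(2), of i i] ws(3) that by auto
    have ge: "0 \<le> ws ! i \<bullet>c ws ! i" by (rule conjugate_square_ge_0_vec)
    from ge have "ws ! i \<bullet>c ws ! i = complex_of_real (Re (ws ! i \<bullet>c ws ! i))"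
      by (auto simp: less_eq_complex_def complex_eq_iff)
    moreover have "s i * s i = complex_of_real (Re (ws ! i \<bullet>c ws ! i))"
      using ge unfolding s_def of_real_mult[symmetric] by (simp add: less_eq_complex_def)
    ultimately show ss: "s i * s i = ws ! i \<bullet>c ws ! i" by simp
    with nz show "s i \<noteq> 0" by auto
    show "cnj (s i) = s i" by (simp add: s_def)
  qed
  define W where "W = mat n n (\<lambda>(i, j). ws ! j $ i / s j)"
  have W: "W \<in> carrier_mat n n" by (simp add: W_def)
  have "mat_adjoint W * W = 1\<^sub>m n"
  proof (rule eq_matI)
    fix i j assume "i < dim_row (1\<^sub>m n :: complex mat)" "j < dim_col (1\<^sub>m n :: complex mat)"
    then have ij: "i < n" "j < n" by auto
    have "(mat_adjoint W * W) $$ (i, j) = (\<Sum>k<n. cnj (ws ! i $ k / s i) * (ws ! j $ k / s j))"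
      using ij W by (auto simp: scalar_prod_def lessThan_atLeast0 W_def)
    also have "\<dots> = (\<Sum>k<n. ws ! j $ k * cnj (ws ! i $ k)) / (s i * s j)"
      unfolding sum_divide_distrib using s(3)[OF ij(1)] by (intro sum.cong) auto
    also have "(\<Sum>k<n. ws ! j $ k * cnj (ws ! i $ k)) = ws ! j \<bullet>c ws ! i"
      using wc[OF ij(1)] wc[OF ij(2)] by (auto simp: scalar_prod_def lessThan_atLeast0)
    also have "ws ! j \<bullet>c ws ! i / (s i * s j) = (if i = j then 1 else 0)"
      using corthogonalD[OF ws(2), of j i] ws(3) ij s[OF ij(1)] by auto
    finally show "(mat_adjoint W * W) $$ (i, j) = 1\<^sub>m n $$ (i, j)" using ij by simp
  qed (use W in auto)
  then have "unitary_mat n W" by (rule unitary_matI[OF W])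
  moreover have "col W 0 = (1 / s 0) \<cdot>\<^sub>v v"
    using n v hd_ws by (intro eq_vecI) (auto simp: W_def)
  ultimately show ?thesis by (rule that)
qed

section \<open>The spectral theorem for normal matrices\<close>

text \<open>The direct sum of the \<open>1 \<times> 1\<close> matrix \<open>c\<close> and \<open>X\<close>, in a form that can be computed
  entrywise by case distinction between \<open>0\<close> and \<open>Suc\<close>.\<close>

definition bordered :: "complex \<Rightarrow> complex mat \<Rightarrow> complex mat" where
  "bordered c X = mat (Suc (dim_row X)) (Suc (dim_col X)) (\<lambda>(i, j). case (i, j) of
     (0, 0) \<Rightarrow> c | (Suc k, Suc l) \<Rightarrow> X $$ (k, l) | _ \<Rightarrow> 0)"

lemma bordered_carrier [simp]:
  "X \<in> carrier_mat n m \<Longrightarrow> bordered c X \<in> carrier_mat (Suc n) (Suc m)"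
  unfolding bordered_def by auto

lemma bordered_mult:
  assumes "X \<in> carrier_mat n n" and "Y \<in> carrier_mat n n"
  shows "bordered c X * bordered d Y = bordered (c * d) (X * Y)"
  using assms
  by (intro eq_matI)
    (auto simp: bordered_def scalar_prod_def sum.atLeast0_lessThan_Suc_shift simp del: sum.op_ivl_Suc
      split: nat.splits intro!: sum.cong)

lemma bordered_adjoint: "mat_adjoint (bordered c X) = bordered (cnj c) (mat_adjoint X)"
  by (intro eq_matI) (auto simp: bordered_def split: nat.splits)

lemma bordered_one: "bordered 1 (1\<^sub>m n) = 1\<^sub>m (Suc n)"
  by (intro eq_matI) (auto simp: bordered_def split: nat.splits)

lemma bordered_mat_diag: "bordered c (mat_diag n d) = mat_diag (Suc n) (case_nat c d)"
  by (intro eq_matI) (auto simp: bordered_def mat_diag_def split: nat.splits)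

lemma bordered_inject:
  assumes "X \<in> carrier_mat n m" and "Y \<in> carrier_mat n m" and eq: "bordered c X = bordered d Y"
  shows "X = Y"
proof (rule eq_matI)
  fix i j assume "i < dim_row Y" "j < dim_col Y"
  then show "X $$ (i, j) = Y $$ (i, j)"
    using assms(1,2) arg_cong[OF eq, of "\<lambda>Z. Z $$ (Suc i, Suc j)"]
    unfolding bordered_def by simp
qed (use assms in auto)

text \<open>When \<open>U\<close> is unitary, this is the matrix with orthonormal eigenvectors the columns of \<open>U\<close> and
  eigenvalues \<open>d 0, \<dots>, d (n - 1)\<close>.\<close>

definition udiag :: "nat \<Rightarrow> complex mat \<Rightarrow> (nat \<Rightarrow> complex) \<Rightarrow> complex mat" where
  "udiag n U d = U * mat_diag n d * mat_adjoint U"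

text \<open>For a normal matrix, row \<open>0\<close> and column \<open>0\<close> have the same Euclidean norm: compare the \<open>(0, 0)\<close>
  entries of \<open>M M\<^sup>*\<close> and \<open>M\<^sup>* M\<close>. If the column has only its diagonal entry, the remaining
  entries of the row have square sum zero, so \<open>M\<close> splits off a \<open>1 \<times> 1\<close> block. This is what turns
  the triangularization of a general matrix into a diagonalization.\<close>

lemma normal_mat_deflate:
  fixes M :: "complex mat"
  assumes M: "M \<in> carrier_mat (Suc m) (Suc m)"
    and normal: "M * mat_adjoint M = mat_adjoint M * M"
    and col0: "\<And>i. i < m \<Longrightarrow> M $$ (Suc i, 0) = 0"
  obtains e X where "M = bordered e X" and "X \<in> carrier_mat m m"
    and "X * mat_adjoint X = mat_adjoint X * X"
proof -
  define X where "X = mat m m (\<lambda>(i, j). M $$ (Suc i, Suc j))"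
  have X: "X \<in> carrier_mat m m" by (simp add: X_def)
  have "(M * mat_adjoint M) $$ (0, 0)
      = M $$ (0, 0) * cnj (M $$ (0, 0)) + (\<Sum>j<m. M $$ (0, Suc j) * cnj (M $$ (0, Suc j)))"
    using M by (auto simp: scalar_prod_def sum.atLeast0_lessThan_Suc_shift lessThan_atLeast0
      simp del: sum.op_ivl_Suc)
  moreover have "(mat_adjoint M * M) $$ (0, 0) = cnj (M $$ (0, 0)) * M $$ (0, 0)"
    using M col0 by (auto simp: scalar_prod_def sum.atLeast0_lessThan_Suc_shift simp del: sum.op_ivl_Suc)
  ultimately have "(\<Sum>j<m. M $$ (0, Suc j) * cnj (M $$ (0, Suc j))) = 0"
    using normal by simp
  then have "complex_of_real (\<Sum>j<m. (cmod (M $$ (0, Suc j)))\<^sup>2) = 0"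
    by (simp only: of_real_sum complex_norm_square)
  then have "(\<Sum>j<m. (cmod (M $$ (0, Suc j)))\<^sup>2) = 0" by (simp only: of_real_eq_0_iff)
  then have row0: "M $$ (0, Suc j) = 0" if "j < m" for j
    using that by (subst (asm) sum_nonneg_eq_0_iff) auto
  define e where "e = M $$ (0, 0)"
  have MX: "M = bordered e X"
    using M col0 row0 by (intro eq_matI) (auto simp: bordered_def X_def e_def split: nat.splits)
  have "bordered (e * cnj e) (X * mat_adjoint X) = bordered (cnj e * e) (mat_adjoint X * X)"
    using normal X unfolding MX by (simp add: bordered_adjoint bordered_mult[of _ m])
  then have "X * mat_adjoint X = mat_adjoint X * X"
    using X by (elim bordered_inject[rotated 2]) (auto intro: mult_carrier_mat[of _ m m])
  with MX X show ?thesis by (rule that)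
qed

text \<open>Induction on the size: in an orthonormal basis that starts with an eigenvector, the first
  column is that of a direct sum, so the matrix deflates to a smaller normal block, which the
  induction hypothesis diagonalizes.\<close>

theorem normal_mat_unitarily_diagonalizable:
  fixes C :: "complex mat"
  assumes "C \<in> carrier_mat n n" and "C * mat_adjoint C = mat_adjoint C * C"
  shows "\<exists>U d. unitary_mat n U \<and> C = udiag n U d"
  using assms
proof (induction n arbitrary: C)
  case 0
  have "unitary_mat 0 (1\<^sub>m 0)" by (rule unitary_matI) auto
  moreover have "C = udiag 0 (1\<^sub>m 0) d" for d using 0(1) by (intro eq_matI) (auto simp: udiag_def)
  ultimately show ?case by blast
next
  case (Suc m)
  let ?n = "Suc m"
  note C = Suc.prems(1)
  note [simp] = assoc_mult_mat[of _ ?n ?n _ ?n _ ?n] mult_carrier_mat[of _ ?n ?n _ ?n]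
  obtain e where "eigenvalue C e" using spectrum_non_empty[OF C] by (auto simp: spectrum_def)
  then obtain v where v: "v \<in> carrier_vec ?n" "v \<noteq> 0\<^sub>v ?n" "C *\<^sub>v v = e \<cdot>\<^sub>v v"
    using C by (auto simp: eigenvalue_def eigenvector_def)
  obtain W c where W: "unitary_mat ?n W" and W0: "col W 0 = c \<cdot>\<^sub>v v"
    using unitary_extending_vector[OF v(1,2)] .
  have Wc: "W \<in> carrier_mat ?n ?n" and WW: "mat_adjoint W * W = 1\<^sub>m ?n" "W * mat_adjoint W = 1\<^sub>m ?n"
    using W by (auto simp: unitary_mat_def)
  define M where "M = mat_adjoint W * C * W"
  have M: "M \<in> carrier_mat ?n ?n" using C Wc by (simp add: M_def)
  have CM: "C = W * M * mat_adjoint W"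
  proof -
    have "W * M * mat_adjoint W = (W * mat_adjoint W) * C * (W * mat_adjoint W)"
      using C Wc by (simp add: M_def)
    then show ?thesis using C WW by simp
  qed
  have M_adj: "mat_adjoint M = mat_adjoint W * mat_adjoint C * W"
    using C Wc by (simp add: M_def mat_adjoint_mult[of _ ?n ?n _ ?n])
  have "M * mat_adjoint M = mat_adjoint W * C * (W * mat_adjoint W) * mat_adjoint C * W"
    unfolding M_adj unfolding M_def using C Wc by simp
  also have "\<dots> = mat_adjoint W * (C * mat_adjoint C) * W"
    using C Wc by (simp add: WW)
  also have "\<dots> = mat_adjoint W * mat_adjoint C * (W * mat_adjoint W) * C * W"
    unfolding Suc.prems(2) using C Wc by (simp add: WW)
  also have "\<dots> = mat_adjoint M * M"
    unfolding M_adj unfolding M_def using C Wc by simp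
  finally have normal: "M * mat_adjoint M = mat_adjoint M * M" .
  (* Column 0 of W is an eigenvector of C, hence the first unit vector is one of M. *)
  have "col (C * W) 0 = C *\<^sub>v col W 0"
    by (rule col_mult2[OF C Wc]) simp
  moreover have "col (mat_adjoint W * (C * W)) 0 = mat_adjoint W *\<^sub>v col (C * W) 0"
    using C Wc by (intro col_mult2[of _ ?n ?n _ ?n]) simp_all
  moreover have "M = mat_adjoint W * (C * W)" using C Wc by (simp add: M_def)
  ultimately have "col M 0 = mat_adjoint W *\<^sub>v (C *\<^sub>v col W 0)" by simp
  also have "C *\<^sub>v col W 0 = e \<cdot>\<^sub>v col W 0"
    unfolding W0 using C v by (simp add: mult_mat_vec[of _ ?n ?n] smult_smult_assoc mult.commute)
  also have "mat_adjoint W *\<^sub>v (e \<cdot>\<^sub>v col W 0) = e \<cdot>\<^sub>v col (mat_adjoint W * W) 0"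
    using Wc carrier_vecI[of "col W 0" ?n]
    by (simp add: mult_mat_vec[of _ ?n ?n "col W 0"] col_mult2[of _ ?n ?n _ ?n])
  finally have M0: "col M 0 = e \<cdot>\<^sub>v col (1\<^sub>m ?n) 0" unfolding WW .
  have "M $$ (Suc i, 0) = 0" if "i < m" for i
    using arg_cong[OF M0, of "\<lambda>x. x $ Suc i"] that M by simp
  then obtain f X where MX: "M = bordered f X" and X: "X \<in> carrier_mat m m"
    and nX: "X * mat_adjoint X = mat_adjoint X * X"
    using normal_mat_deflate[OF M normal] by blast
  obtain V d where V: "unitary_mat m V" and XV: "X = udiag m V d"
    using Suc.IH[OF X nX] by blast
  have Vc: "V \<in> carrier_mat m m" "mat_adjoint V * V = 1\<^sub>m m" using V by (auto simp: unitary_mat_def)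
  let ?V = "bordered 1 V"
  have uV: "unitary_mat ?n ?V"
    using Vc by (intro unitary_matI) (simp_all add: bordered_adjoint bordered_mult[of _ m] bordered_one)
  have MV: "M = ?V * mat_diag ?n (case_nat f d) * mat_adjoint ?V"
    using Vc unfolding MX XV udiag_def bordered_mat_diag[symmetric]
    by (simp add: bordered_adjoint bordered_mult[of _ m])
  have "C = udiag ?n (W * ?V) (case_nat f d)"
    unfolding CM MV udiag_def using Wc Vc by (simp add: mat_adjoint_mult[of _ ?n ?n _ ?n])
  with unitary_mat_mult[OF W uV] show ?case by blast
qed


section \<open>Algebra of matrices diagonalized by a fixed unitary\<close>

lemma udiag_carrier [simp]: "unitary_mat n U \<Longrightarrow> udiag n U d \<in> carrier_mat n n"
  unfolding udiag_def unitary_mat_def by (auto intro!: mult_carrier_mat[of _ n n])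

lemma udiag_cong:
  assumes "\<And>i. i < n \<Longrightarrow> d i = e i"
  shows "udiag n U d = udiag n U e"
proof -
  have "mat_diag n d = mat_diag n e" using assms by (intro eq_matI) (auto simp: mat_diag_def)
  then show ?thesis by (simp add: udiag_def)
qed

lemma udiag_one: "unitary_mat n U \<Longrightarrow> udiag n U (\<lambda>i. 1) = 1\<^sub>m n"
  unfolding udiag_def unitary_mat_def by auto

lemma udiag_mult:
  assumes "unitary_mat n U"
  shows "udiag n U d * udiag n U e = udiag n U (\<lambda>i. d i * e i)"
proof -
  note [simp] = assoc_mult_mat[of _ n n _ n _ n] mult_carrier_mat[of _ n n _ n]
    left_mult_one_mat[of _ n n] right_mult_one_mat[of _ n n]
  have U: "U \<in> carrier_mat n n" "mat_adjoint U * U = 1\<^sub>m n" using assms by (auto simp: unitary_mat_def)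
  have "udiag n U d * udiag n U e
      = U * mat_diag n d * (mat_adjoint U * U) * mat_diag n e * mat_adjoint U"
    using U(1) by (simp add: udiag_def)
  also have "\<dots> = U * (mat_diag n d * mat_diag n e) * mat_adjoint U"
    unfolding U(2) using U(1) by (simp del: mat_diag_diag)
  finally show ?thesis by (simp add: udiag_def)
qed

lemma udiag_add:
  assumes "unitary_mat n U"
  shows "udiag n U d + udiag n U e = udiag n U (\<lambda>i. d i + e i)"
proof -
  have U: "U \<in> carrier_mat n n" using assms by (auto simp: unitary_mat_def)
  have "mat_diag n (\<lambda>i. d i + e i) = mat_diag n d + mat_diag n e"
    by (intro eq_matI) (auto simp: mat_diag_def)
  then show ?thesis using U
    by (simp add: udiag_def mult_add_distrib_mat[of _ n n _ n] add_mult_distrib_mat[of _ n n _ _ n]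
        mult_carrier_mat[of _ n n _ n])
qed

lemma udiag_smult:
  assumes "unitary_mat n U"
  shows "c \<cdot>\<^sub>m udiag n U d = udiag n U (\<lambda>i. c * d i)"
proof -
  have U: "U \<in> carrier_mat n n" using assms by (auto simp: unitary_mat_def)
  have "mat_diag n (\<lambda>i. c * d i) = c \<cdot>\<^sub>m mat_diag n d"
    by (intro eq_matI) (auto simp: mat_diag_def)
  then show ?thesis using U
    by (simp add: udiag_def mult_smult_distrib[of _ n n _ n] mult_smult_assoc_mat[of _ n n _ n]
        mult_carrier_mat[of _ n n _ n])
qed

lemma udiag_minus:
  assumes U: "unitary_mat n U"
  shows "udiag n U d - udiag n U e = udiag n U (\<lambda>i. d i - e i)"
proof -
  have "udiag n U d - udiag n U e = udiag n U d + (- 1) \<cdot>\<^sub>m udiag n U e"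
    using udiag_carrier[OF U, of d] udiag_carrier[OF U, of e] by (intro eq_matI) auto
  then show ?thesis by (simp add: udiag_smult[OF U] udiag_add[OF U])
qed

lemma udiag_adjoint:
  assumes "unitary_mat n U"
  shows "mat_adjoint (udiag n U d) = udiag n U (\<lambda>i. cnj (d i))"
proof -
  have U: "U \<in> carrier_mat n n" using assms by (auto simp: unitary_mat_def)
  then show ?thesis
    by (simp add: udiag_def mat_adjoint_mult[of _ n n _ n] mat_adjoint_mat_diag
        mult_carrier_mat[of _ n n _ n] assoc_mult_mat[of _ n n _ n _ n])
qed

lemma inv_mat_eqI:
  assumes A: "A \<in> carrier_mat n n" and B: "B \<in> carrier_mat n n" and AB: "A * B = 1\<^sub>m n"
  shows "inv_mat A = B"
proof -
  have BA: "B * A = 1\<^sub>m n" using mat_mult_left_right_inverse[OF A B AB] .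
  have "A \<in> Units (ring_mat TYPE(complex) n b)" for b :: unit
    using A B AB BA by (auto simp: Units_def ring_mat_def)
  then obtain C where C: "mat_inverse A = Some C"
    using mat_inverse(1)[OF A, where b = "()"] by (cases "mat_inverse A") auto
  then have AC: "A * C = 1\<^sub>m n" "C \<in> carrier_mat n n" using mat_inverse(2)[OF A] by auto
  have "B = B * (A * C)" using AC B by simp
  also have "\<dots> = (B * A) * C" using A B AC by (simp add: assoc_mult_mat[of _ n n _ n _ n])
  also have "\<dots> = C" using BA AC by simp
  finally show ?thesis by (simp add: inv_mat_def C)
qed

lemma inv_mat_udiag:
  assumes U: "unitary_mat n U" and nz: "\<And>i. i < n \<Longrightarrow> d i \<noteq> 0"
  shows "inv_mat (udiag n U d) = udiag n U (\<lambda>i. 1 / d i)"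
proof (rule inv_mat_eqI)
  have "udiag n U (\<lambda>i. d i * (1 / d i)) = udiag n U (\<lambda>i. 1)" using nz by (intro udiag_cong) auto
  then show "udiag n U d * udiag n U (\<lambda>i. 1 / d i) = 1\<^sub>m n"
    by (simp add: udiag_mult[OF U] udiag_one[OF U])
qed (use U in auto)

section \<open>Functional calculus and positivity on a diagonalization\<close>

text \<open>Let \<open>W = V\<^sup>* U\<close> be the change of basis between two diagonalizations of one matrix. It
  intertwines the two diagonal matrices, \<open>W\<^sub>i\<^sub>j d\<^sub>j = e\<^sub>i W\<^sub>i\<^sub>j\<close>, so \<open>W\<^sub>i\<^sub>j\<close> vanishes unless
  \<open>d\<^sub>j = e\<^sub>i\<close>. Hence it also intertwines the images of the diagonal matrices under any \<open>f\<close>.\<close>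

lemma udiag_fun_unique:
  assumes U: "unitary_mat n U" and V: "unitary_mat n V"
    and eq: "udiag n U (\<lambda>i. complex_of_real (d i)) = udiag n V (\<lambda>i. complex_of_real (e i))"
  shows "udiag n U (\<lambda>i. complex_of_real (f (d i))) = udiag n V (\<lambda>i. complex_of_real (f (e i)))"
proof -
  note [simp] = assoc_mult_mat[of _ n n _ n _ n] mult_carrier_mat[of _ n n _ n]
    left_mult_one_mat[of _ n n] right_mult_one_mat[of _ n n]
  let ?D = "\<lambda>g. mat_diag n (\<lambda>i. complex_of_real (g (d i)))"
  let ?E = "\<lambda>g. mat_diag n (\<lambda>i. complex_of_real (g (e i)))"
  have Uc: "U \<in> carrier_mat n n" "mat_adjoint U * U = 1\<^sub>m n" "U * mat_adjoint U = 1\<^sub>m n"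
    using U by (auto simp: unitary_mat_def)
  have Vc: "V \<in> carrier_mat n n" "mat_adjoint V * V = 1\<^sub>m n" "V * mat_adjoint V = 1\<^sub>m n"
    using V by (auto simp: unitary_mat_def)
  define W where "W = mat_adjoint V * U"
  have W: "W \<in> carrier_mat n n" using Uc Vc by (simp add: W_def)
  have "W * ?D (\<lambda>x. x) = mat_adjoint V * U * ?D (\<lambda>x. x) * (mat_adjoint U * U)"
    unfolding Uc(2) W_def using Uc(1) Vc(1) by simp
  also have "\<dots> = mat_adjoint V * udiag n U (\<lambda>i. complex_of_real (d i)) * U"
    using Uc(1) Vc(1) by (simp add: udiag_def)
  also have "\<dots> = (mat_adjoint V * V) * ?E (\<lambda>x. x) * mat_adjoint V * U"
    unfolding eq using Uc(1) Vc(1) by (simp add: udiag_def)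
  also have "\<dots> = ?E (\<lambda>x. x) * W"
    unfolding Vc(2) W_def using Uc(1) Vc(1) by simp
  finally have WD: "W * ?D (\<lambda>x. x) = ?E (\<lambda>x. x) * W" .
  have entry: "W $$ (i, j) = 0 \<or> d j = e i" if "i < n" "j < n" for i j
    using arg_cong[OF WD, of "\<lambda>Z. Z $$ (i, j)"] that
    unfolding mat_diag_mult_right[OF W] mat_diag_mult_left[OF W] by (simp add: mult.commute)
  have "W * ?D f = ?E f * W"
    unfolding mat_diag_mult_right[OF W] mat_diag_mult_left[OF W]
    by (intro eq_matI) (use entry in \<open>fastforce simp: mult.commute\<close>)+
  then have fW: "mat_adjoint V * (U * ?D f) = ?E f * (mat_adjoint V * U)"
    unfolding W_def using Uc(1) Vc(1) by simp
  have "udiag n U (\<lambda>i. complex_of_real (f (d i)))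
      = V * mat_adjoint V * U * ?D f * mat_adjoint U"
    unfolding Vc(3) using Uc(1) by (simp add: udiag_def)
  also have "\<dots> = V * (mat_adjoint V * (U * ?D f)) * mat_adjoint U"
    using Uc(1) Vc(1) by simp
  also have "\<dots> = V * ?E f * mat_adjoint V * (U * mat_adjoint U)"
    unfolding fW using Uc(1) Vc(1) by simp
  also have "\<dots> = udiag n V (\<lambda>i. complex_of_real (f (e i)))"
    unfolding Uc(3) using Vc(1) by (simp add: udiag_def)
  finally show ?thesis .
qed

lemma fun_calc_udiag:
  assumes U: "unitary_mat n U"
  shows "fun_calc f (udiag n U (\<lambda>i. complex_of_real (d i))) = udiag n U (\<lambda>i. complex_of_real (f (d i)))"
proof -
  let ?A = "udiag n U (\<lambda>i. complex_of_real (d i))"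
  have dim: "dim_row ?A = n" using udiag_carrier[OF U, of "\<lambda>i. complex_of_real (d i)"] by auto
  show ?thesis
    unfolding fun_calc_def dim udiag_def[symmetric]
    by (rule the_equality) (use U udiag_fun_unique[OF U] in metis)+
qed

lemma mat_powr_udiag:
  assumes "unitary_mat n U"
  shows "mat_powr (udiag n U (\<lambda>i. complex_of_real (d i))) r = udiag n U (\<lambda>i. complex_of_real (d i powr r))"
  unfolding mat_powr_def by (rule fun_calc_udiag[OF assms])

lemma hermitian_udiag:
  "unitary_mat n U \<Longrightarrow> hermitian_mat (udiag n U (\<lambda>i. complex_of_real (d i)))"
  by (simp add: hermitian_mat_def udiag_adjoint)

text \<open>With \<open>R\<close> the diagonal square root, \<open>R\<close> is Hermitian and the quadratic form of \<open>R\<^sup>2\<close> at \<open>v\<close>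
  is the squared norm of \<open>R v\<close>.\<close>

lemma psd_udiag:
  assumes U: "unitary_mat n U" and nonneg: "\<And>i. i < n \<Longrightarrow> 0 \<le> d i"
  shows "psd_mat (udiag n U (\<lambda>i. complex_of_real (d i)))"
proof -
  let ?A = "udiag n U (\<lambda>i. complex_of_real (d i))"
  define R where "R = udiag n U (\<lambda>i. complex_of_real (sqrt (d i)))"
  have R: "R \<in> carrier_mat n n" "mat_adjoint R = R"
    using U by (simp_all add: R_def udiag_adjoint)
  have A: "?A = R * R"
    unfolding R_def udiag_mult[OF U] using nonneg
    by (intro udiag_cong) (simp flip: of_real_mult)
  have "0 \<le> (?A *\<^sub>v v) \<bullet>c v" if v: "v \<in> carrier_vec n" for v
  proof -
    have "(?A *\<^sub>v v) \<bullet>c v = (R *\<^sub>v (R *\<^sub>v v)) \<bullet>c v"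
      unfolding A using R(1) v by (simp add: assoc_mult_mat_vec[of _ n n _ n])
    also have "\<dots> = (R *\<^sub>v v) \<bullet>c (R *\<^sub>v v)"
      using adjoint_cscalar_prod[of R n n "R *\<^sub>v v" v] R v by simp
    also have "0 \<le> \<dots>" by (rule conjugate_square_ge_0_vec)
    finally show ?thesis .
  qed
  moreover have "dim_row ?A = n" using R by (simp add: A)
  ultimately show ?thesis unfolding psd_mat_def using hermitian_udiag[OF U] by simp
qed

text \<open>Evaluate the quadratic form at the eigenvector given by column \<open>i\<close> of \<open>U\<close>.\<close>

lemma pd_udiag_pos:
  assumes U: "unitary_mat n U" and pd: "pd_mat (udiag n U (\<lambda>i. complex_of_real (d i)))" and i: "i < n"
  shows "0 < d i"
proof -
  let ?A = "udiag n U (\<lambda>i. complex_of_real (d i))"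
  let ?v = "col U i"
  note [simp] = assoc_mult_mat[of _ n n _ n _ n] mult_carrier_mat[of _ n n _ n]
    left_mult_one_mat[of _ n n] right_mult_one_mat[of _ n n]
  have Uc: "U \<in> carrier_mat n n" "mat_adjoint U * U = 1\<^sub>m n" using U by (auto simp: unitary_mat_def)
  have A: "?A \<in> carrier_mat n n" using U by simp
  have v: "?v \<in> carrier_vec n" using Uc by auto
  have "mat_adjoint U *\<^sub>v ?v = col (1\<^sub>m n) i"
    using Uc i by (simp add: col_mult2[of _ n n _ n, symmetric])
  then have v0: "?v \<noteq> 0\<^sub>v n"
    using Uc i by (auto dest: arg_cong[of _ _ "\<lambda>x. x $ i"])
  have "?A * U = U * mat_diag n (\<lambda>i. complex_of_real (d i))"
    using Uc by (simp add: udiag_def)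
  then have "?A *\<^sub>v ?v = col (U * mat_diag n (\<lambda>i. complex_of_real (d i))) i"
    using A Uc i by (simp add: col_mult2[of _ n n _ n, symmetric])
  also have "\<dots> = complex_of_real (d i) \<cdot>\<^sub>v ?v"
    unfolding mat_diag_mult_right[OF Uc(1)] using Uc i by (intro eq_vecI) auto
  finally have ev: "?A *\<^sub>v ?v = complex_of_real (d i) \<cdot>\<^sub>v ?v" .
  have "0 < (?A *\<^sub>v ?v) \<bullet>c ?v"
    using pd v v0 A unfolding pd_mat_def by auto
  then have "0 < complex_of_real (d i) * (?v \<bullet>c ?v)"
    unfolding ev using v by simp
  moreover have "0 < ?v \<bullet>c ?v" using v v0 by simp
  ultimately show ?thesis by (auto simp: less_complex_def zero_less_mult_iff)
qed

section \<open>Simultaneous diagonalization\<close>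

text \<open>Commutation of the Hermitian matrices \<open>A\<close> and \<open>B\<close> makes \<open>C = A + \<i>B\<close> normal, and
  \<open>A = (C + C\<^sup>*)/2\<close>, \<open>B = (C - C\<^sup>*)/(2\<i>)\<close>. Since \<open>C\<^sup>*\<close> is diagonal in every orthonormal
  eigenbasis of \<open>C\<close>, so are \<open>A\<close> and \<open>B\<close>.\<close>

theorem commuting_hermitian_simultaneously_diagonalizable:
  assumes A: "A \<in> carrier_mat n n" "hermitian_mat A" and B: "B \<in> carrier_mat n n" "hermitian_mat B"
    and comm: "A * B = B * A"
  obtains U a b where "unitary_mat n U"
    and "A = udiag n U (\<lambda>i. complex_of_real (a i))" and "B = udiag n U (\<lambda>i. complex_of_real (b i))"
proof -
  note [simp] = mult_carrier_mat[of _ n n _ n]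
  define C where "C = A + \<i> \<cdot>\<^sub>m B"
  have C: "C \<in> carrier_mat n n" using A B by (simp add: C_def)
  have adj: "mat_adjoint A = A" "mat_adjoint B = B" using A B by (auto simp: hermitian_mat_def)
  have C_adj: "mat_adjoint C = A + (- \<i>) \<cdot>\<^sub>m B"
    using A(1) B(1) unfolding C_def
    by (subst mat_adjoint_add[of _ n n]) (simp_all add: mat_adjoint_smult adj)
  have "C * mat_adjoint C = mat_adjoint C * C"
    unfolding C_adj unfolding C_def using A(1) B(1) comm
    by (intro eq_matI)
      (simp_all add: add_mult_distrib_mat[of _ n n _ _ n] mult_add_distrib_mat[of _ n n _ n]
        mult_smult_distrib[of _ n n _ n] mult_smult_assoc_mat[of _ n n _ n], simp add: algebra_simps)
  then obtain U d where U: "unitary_mat n U" and Cd: "C = udiag n U d"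
    using normal_mat_unitarily_diagonalizable[OF C] by blast
  have Cd': "mat_adjoint C = udiag n U (\<lambda>i. cnj (d i))" unfolding Cd by (rule udiag_adjoint[OF U])
  have "A = (1 / 2) \<cdot>\<^sub>m (C + mat_adjoint C)"
    unfolding C_adj unfolding C_def using A B by (intro eq_matI) auto
  also have "\<dots> = udiag n U (\<lambda>i. complex_of_real (Re (d i)))"
    unfolding Cd' unfolding Cd udiag_add[OF U] udiag_smult[OF U]
    by (intro udiag_cong) (simp add: complex_eq_iff)
  finally have Ad: "A = udiag n U (\<lambda>i. complex_of_real (Re (d i)))" .
  have "B = (- \<i> / 2) \<cdot>\<^sub>m (C + (- 1) \<cdot>\<^sub>m mat_adjoint C)"
    unfolding C_adj unfolding C_def using A B by (intro eq_matI) (auto simp: algebra_simps)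
  also have "\<dots> = udiag n U (\<lambda>i. complex_of_real (Im (d i)))"
    unfolding Cd' unfolding Cd udiag_smult[OF U] udiag_add[OF U]
    by (intro udiag_cong) (simp add: complex_eq_iff)
  finally have Bd: "B = udiag n U (\<lambda>i. complex_of_real (Im (d i)))" .
  from U Ad Bd show ?thesis by (rule that)
qed

section \<open>The scalar inequality\<close>

text \<open>Bernoulli's inequality for exponents in \<open>[0, 1]\<close>: the concave function \<open>x\<^sup>r\<close> lies below its
  tangent at \<open>1\<close>.\<close>

lemma powr_le_affine:
  fixes x r :: real
  assumes x: "0 < x" and r: "0 \<le> r" "r \<le> 1"
  shows "x powr r \<le> r * x + (1 - r)"
proof -
  define m where "m = r * x + (1 - r)"
  have m: "0 < m"
  proof (cases "r = 0")
    case False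
    then have "0 < r * x" using x r by simp
    then show ?thesis using r by (simp add: m_def)
  qed (simp add: m_def)
  (* Weighted concavity of ln at x and 1, whose weighted mean is m: both logarithms are
     bounded by the tangent at m, and the tangent terms cancel. *)
  have "r * ln (x / m) + (1 - r) * ln (1 / m) \<le> r * (x / m - 1) + (1 - r) * (1 / m - 1)"
    using x m r by (intro add_mono mult_left_mono ln_le_minus_one) auto
  also have "\<dots> = (r * x + (1 - r)) / m - 1" by (simp add: field_simps diff_divide_distrib add_divide_distrib)
  also have "\<dots> = 0" using m by (simp add: m_def)
  finally have "r * ln x \<le> ln m" using x m by (simp add: ln_div algebra_simps)
  then have "exp (r * ln x) \<le> exp (ln m)" by (simp only: exp_le_cancel_iff)
  then have "exp (r * ln x) \<le> m" using m by (simp only: exp_ln)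
  then show ?thesis using x by (simp add: powr_def m_def)
qed

text \<open>The scalar form of the theorem; the identity \<open>pq = ab(rk + 1 - r)\<close> below is where the
  exponent \<open>4t(1-t)\<close> and the constant \<open>(a/b + b/a + 2)/4\<close> come from.\<close>

lemma powr_mult_harmonic_heinz_le_arith:
  fixes a b t :: real
  assumes ab: "0 < a" "0 < b" and t: "0 \<le> t" "t \<le> 1"
  shows "((a / b + b / a + 2) / 4) powr (4 * t * (1 - t))
      * ((1 / ((1 - t) / a + t / b) + 1 / (t / a + (1 - t) / b)) / 2) \<le> (a + b) / 2"
proof -
  define r where "r = 4 * t * (1 - t)"
  define k where "k = (a / b + b / a + 2) / 4"
  define p where "p = (1 - t) * b + t * a"
  define q where "q = t * b + (1 - t) * a"
  have r: "0 \<le> r" "r \<le> 1"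
    using t zero_le_power2[of "2 * t - 1"] by (simp add: r_def, simp add: r_def power2_eq_square algebra_simps)
  have k: "0 < k" using ab by (simp add: k_def add_pos_pos)
  have pos: "0 < p" "0 < q"
    using ab t unfolding p_def q_def
    by (cases "t = 0"; simp add: add_nonneg_pos add_pos_nonneg)+
  have "(1 - t) / a + t / b = p / (a * b)" "t / a + (1 - t) / b = q / (a * b)"
    using ab by (auto simp: p_def q_def field_simps)
  then have H: "(1 / ((1 - t) / a + t / b) + 1 / (t / a + (1 - t) / b)) / 2 = (a + b) / 2 * (a * b / (p * q))"
    using pos by (simp add: p_def q_def field_simps)
  have pq: "p * q = a * b * (r * k + (1 - r))"
    using ab by (simp add: p_def q_def r_def k_def field_simps power2_eq_square)
  have "k powr r * (a * b) \<le> p * q"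
    unfolding pq using powr_le_affine[OF k r] ab by (simp add: mult.commute)
  then have "k powr r * (a * b / (p * q)) \<le> 1"
    using pos by simp
  then have "(a + b) / 2 * (k powr r * (a * b / (p * q))) \<le> (a + b) / 2 * 1"
    using ab by (intro mult_left_mono) auto
  then show ?thesis unfolding H r_def[symmetric] k_def[symmetric] by (simp add: mult_ac)
qed

section \<open>The matrix inequality\<close>

lemma harm_mean_udiag:
  assumes U: "unitary_mat n U" and ab: "\<And>i. i < n \<Longrightarrow> 0 < a i \<and> 0 < b i"
    and t: "0 \<le> t" "t \<le> 1"
  shows "harm_mean t (udiag n U (\<lambda>i. complex_of_real (a i))) (udiag n U (\<lambda>i. complex_of_real (b i)))
    = udiag n U (\<lambda>i. complex_of_real (1 / ((1 - t) / a i + t / b i)))"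
proof -
  have nz: "complex_of_real (a i) \<noteq> 0" "complex_of_real (b i) \<noteq> 0" if "i < n" for i
    using ab[OF that] by auto
  have pos: "0 < (1 - t) / a i + t / b i" if "i < n" for i
    using ab[OF that] t by (cases "t = 0") (auto intro: add_nonneg_pos)
  have "complex_of_real (1 - t) * (1 / complex_of_real (a i)) + complex_of_real t * (1 / complex_of_real (b i)) \<noteq> 0"
    if "i < n" for i
  proof -
    have "complex_of_real (1 - t) * (1 / complex_of_real (a i)) + complex_of_real t * (1 / complex_of_real (b i))
        = complex_of_real ((1 - t) / a i + t / b i)" by simp
    then show ?thesis using pos[OF that] by (metis of_real_eq_0_iff less_irrefl)
  qed
  then show ?thesis
    unfolding harm_mean_def using nz
    by (simp add: inv_mat_udiag[OF U] udiag_smult[OF U] udiag_add[OF U])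
qed

theorem theorem3p6:
  fixes n :: nat and A B :: "complex mat" and t :: real
  assumes "A \<in> carrier_mat n n" and "B \<in> carrier_mat n n"
    and "pd_mat A" and "pd_mat B"
    and "A * B = B * A"
    and "0 \<le> t" and "t \<le> 1"
  shows "mat_powr ((1 / 4) \<cdot>\<^sub>m (A * inv_mat B + B * inv_mat A + 2 \<cdot>\<^sub>m 1\<^sub>m n)) (4 * t * (1 - t))
           * harm_heinz_mean t A B
         \<le>\<^sub>L arith_mean A B"
proof -
  have "hermitian_mat A" "hermitian_mat B" using assms(3,4) by (auto simp: pd_mat_def)
  then obtain U a b where U: "unitary_mat n U"
    and A: "A = udiag n U (\<lambda>i. complex_of_real (a i))" and B: "B = udiag n U (\<lambda>i. complex_of_real (b i))"
    using commuting_hermitian_simultaneously_diagonalizable assms(1,2,5) by metis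
  have pos: "0 < a i \<and> 0 < b i" if "i < n" for i
    using pd_udiag_pos[OF U _ that] assms(3,4) unfolding A B by blast
  define k where "k i = (a i / b i + b i / a i + 2) / 4" for i
  define h where "h i = (1 / ((1 - t) / a i + t / b i) + 1 / (t / a i + (1 - t) / b i)) / 2" for i
  define r where "r = 4 * t * (1 - t)"
  have inv_A: "inv_mat A = udiag n U (\<lambda>i. 1 / complex_of_real (a i))"
    unfolding A using pos by (intro inv_mat_udiag[OF U]) force
  have inv_B: "inv_mat B = udiag n U (\<lambda>i. 1 / complex_of_real (b i))"
    unfolding B using pos by (intro inv_mat_udiag[OF U]) force
  have K: "(1 / 4) \<cdot>\<^sub>m (A * inv_mat B + B * inv_mat A + 2 \<cdot>\<^sub>m 1\<^sub>m n) = udiag n U (\<lambda>i. complex_of_real (k i))"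
    unfolding inv_A inv_B unfolding A B udiag_one[OF U, symmetric]
      udiag_mult[OF U] udiag_smult[OF U] udiag_add[OF U]
    by (intro udiag_cong) (simp add: k_def)
  have H: "harm_heinz_mean t A B = udiag n U (\<lambda>i. complex_of_real (h i))"
    unfolding harm_heinz_mean_def A B using assms(6,7)
    by (simp add: harm_mean_udiag[OF U pos] udiag_smult[OF U] udiag_add[OF U] h_def del: of_real_add)
      (simp add: add_divide_distrib)
  have M: "arith_mean A B = udiag n U (\<lambda>i. complex_of_real ((a i + b i) / 2))"
    unfolding arith_mean_def A B udiag_smult[OF U] udiag_add[OF U]
    by (intro udiag_cong) simp
  have P: "mat_powr ((1 / 4) \<cdot>\<^sub>m (A * inv_mat B + B * inv_mat A + 2 \<cdot>\<^sub>m 1\<^sub>m n)) r * harm_heinz_mean t A B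
      = udiag n U (\<lambda>i. complex_of_real (k i powr r * h i))"
    unfolding K H mat_powr_udiag[OF U] udiag_mult[OF U] by simp
  have "psd_mat (udiag n U (\<lambda>i. complex_of_real ((a i + b i) / 2 - k i powr r * h i)))"
    using pos powr_mult_harmonic_heinz_le_arith[OF _ _ assms(6,7)]
    by (intro psd_udiag[OF U]) (simp add: k_def h_def r_def)
  then have "psd_mat (arith_mean A B
      - mat_powr ((1 / 4) \<cdot>\<^sub>m (A * inv_mat B + B * inv_mat A + 2 \<cdot>\<^sub>m 1\<^sub>m n)) r * harm_heinz_mean t A B)"
    unfolding M P udiag_minus[OF U] by simp
  then show ?thesis
    unfolding loewner_le_def r_def[symmetric]
    using hermitian_udiag[OF U] udiag_carrier[OF U] unfolding M P
    by (metis carrier_matD(1))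
qed

end
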